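(* Let $(a_n)$ be an arithmetic sequence and let $(e_n)$ be an arithmetic-type sequence corresponding to $(a_n)$. If $(e_n)$ is weakly $L$-invariant, then $|t^{s}_{(e_n)}(\mathbb{T})|=\mathfrak{c}$.
   Context: $\mathbb{N}=\{1,2,3,\dots\}$, $\mathbb{T}=\mathbb{R}/\mathbb{Z}$, $\mathfrak{c}$ is the cardinality of the continuum, $[m,n]$ denotes the set of integers $j$ with $m\le j\le n$, and $\|x\|$ denotes the distance from a real $x$ to the nearest integer (well defined on $\mathbb{T}$). For $A\subseteq\mathbb{N}$, $\overline{d}(A)=\limsup_{n\to\infty}|A\cap[0,n-1]|/n$, $\underline{d}(A)=\liminf_{n\to\infty}|A\cap[0,n-1]|/n$, and $d(A)$ denotes the common value when they agree (natural density). An arithmetic sequence is a sequence of positive integers $1=a_0<a_1<a_2<\cdots$ with $a_n\mid a_{n+1}$ for every $n$; its ratios are $b_n=a_n/a_{n-1}$ for $n\ge 1$. Let $(d_n)$ be the increasing enumeration of the set $\{r a_k : k\ge 0,\ 1\le r<b_{k+1}\}$. An arithmetic-type sequence corresponding to $(a_n)$ is a strictly increasing sequence of integers $(e_n)_{n\in\mathbb{N}}$ such that $(a_n)$ is a subsequence of $(e_n)$ and $(e_n)$ is a subsequence of $(d_n)$. For $k\ge 0$, $n_k$ denotes the index with $e_{n_k}=a_k$ (so $n_0=1$). The lifting function $L:\mathcal{P}(\mathbb{N})\to\mathcal{P}(\mathbb{N})$ is $L(A)=\bigcup_{k\in A}[n_{k-1},n_k-1]$. For $m\in\mathbb{N}\cup\{0\}$,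 $A-m=\{n\in\mathbb{N}: n=a-m \text{ for some } a\in A\}$. $(e_n)$ is weakly $L$-invariant if there exists an infinite $A\subseteq\mathbb{N}$ such that $d(L(A-m))=0$ for each $m\in\mathbb{N}\cup\{0\}$. The statistically characterized subgroup is $t^s_{(e_n)}(\mathbb{T})=\{x\in\mathbb{T}: e_nx\to 0 \text{ statistically}\}$, i.e. the set of $x\in\mathbb{T}$ such that $d(\{n\in\mathbb{N}:\|e_nx\|\ge\varepsilon\})=0$ for every $\varepsilon>0$. *)

theory Defs
  imports "HOL-Analysis.Analysis" "HOL-Library.Equipollence" "HOL-Library.Infinite_Set"
begin

text \<open>
  Throughout, the positive integers are rendered as the subset \<open>{1..}\<close> of \<^typ>\<open>nat\<close>:
  sequences indexed by positive integers are functions on \<^typ>\<open>nat\<close> whose value at \<open>0\<close> is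
  never used.
\<close>

subsection \<open>The circle group\<close>

quotient_type circle = real / "\<lambda>x y::real. x - y \<in> \<int>"
proof (rule equivpI)
  show "reflp (\<lambda>x y::real. x - y \<in> \<int>)"
    by (simp add: reflp_def)
  show "symp (\<lambda>x y::real. x - y \<in> \<int>)"
  proof (rule sympI)
    fix x y :: real
    assume "x - y \<in> \<int>"
    then have "- (x - y) \<in> \<int>" by (rule Ints_minus)
    then show "y - x \<in> \<int>" by simp
  qed
  show "transp (\<lambda>x y::real. x - y \<in> \<int>)"
  proof (rule transpI)
    fix x y z :: real
    assume "x - y \<in> \<int>" "y - z \<in> \<int>"
    then have "(x - y) + (y - z) \<in> \<int>" by (rule Ints_add)
    then show "x - z \<in> \<int>" by simp
  qed
qed

lift_definition circle_mult :: "int \<Rightarrow> circle \<Rightarrow> circle"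
  is "\<lambda>m x. of_int m * x"
proof -
  fix m :: int and x y :: real
  assume "x - y \<in> \<int>"
  then have "of_int m * (x - y) \<in> \<int>" by (intro Ints_mult Ints_of_int)
  then show "of_int m * x - of_int m * y \<in> \<int>" by (simp add: right_diff_distrib)
qed

lemma infdist_Ints_cong:
  fixes x y :: real
  assumes "x - y \<in> \<int>"
  shows "infdist x \<int> = infdist y \<int>"
proof -
  have le: "infdist u \<int> \<le> infdist v \<int>" if "u - v \<in> \<int>" for u v :: real
  proof -
    have "infdist u \<int> \<le> dist v n" if "n \<in> \<int>" for n
    proof -
      have "n + (u - v) \<in> \<int>" using that \<open>u - v \<in> \<int>\<close> by (rule Ints_add)
      then have "infdist u \<int> \<le> dist u (n + (u - v))" by (rule infdist_le)
      also have "\<dots> = dist v n" by (simp add: dist_real_def)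
      finally show ?thesis .
    qed
    moreover have "(\<int> :: real set) \<noteq> {}" using Ints_0 by blast
    ultimately show ?thesis
      by (subst (2) infdist_notempty) (auto intro!: cINF_greatest)
  qed
  have "- (x - y) \<in> \<int>" using assms by (rule Ints_minus)
  then have "y - x \<in> \<int>" by simp
  with assms show ?thesis by (intro antisym le)
qed

lift_definition circle_norm :: "circle \<Rightarrow> real"
  is "\<lambda>x. infdist x \<int>"
  by (rule infdist_Ints_cong)

subsection \<open>Natural density\<close>

definition upper_density :: "nat set \<Rightarrow> ereal" where
  "upper_density A = limsup (\<lambda>n. ereal (real (card (A \<inter> {..<n})) / real n))"

definition lower_density :: "nat set \<Rightarrow> ereal" where
  "lower_density A = liminf (\<lambda>n. ereal (real (card (A \<inter> {..<n})) / real n))"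

definition has_density :: "nat set \<Rightarrow> real \<Rightarrow> bool" where
  "has_density A \<delta> \<longleftrightarrow> upper_density A = ereal \<delta> \<and> lower_density A = ereal \<delta>"

subsection \<open>Arithmetic and arithmetic-type sequences\<close>

definition arithmetic_sequence :: "(nat \<Rightarrow> nat) \<Rightarrow> bool" where
  "arithmetic_sequence a \<longleftrightarrow> a 0 = 1 \<and> strict_mono a \<and> (\<forall>n. a n dvd a (Suc n))"

definition ratio :: "(nat \<Rightarrow> nat) \<Rightarrow> nat \<Rightarrow> nat" where
  "ratio a n = a n div a (n - 1)"

definition multiples_set :: "(nat \<Rightarrow> nat) \<Rightarrow> nat set" where
  "multiples_set a = {r * a k | r k. 1 \<le> r \<and> r < ratio a (Suc k)}"

text \<open>
  The sequence \<open>(d\<^sub>n)\<close> is \<^term>\<open>enumerate (multiples_set a)\<close>; it is indexed from \<open>0\<close>, which does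
  not affect which sequences are its subsequences. In contrast \<open>(e\<^sub>n)\<close> is indexed from \<open>1\<close>, as
  densities of sets of indices refer to it.
\<close>

definition arithmetic_type :: "(nat \<Rightarrow> nat) \<Rightarrow> (nat \<Rightarrow> int) \<Rightarrow> bool" where
  "arithmetic_type a e \<longleftrightarrow>
     strict_mono_on {1..} e \<and>
     (\<exists>\<phi>. strict_mono \<phi> \<and> (\<forall>k. 1 \<le> \<phi> k \<and> int (a k) = e (\<phi> k))) \<and>
     (\<exists>\<psi>. strict_mono_on {1..} \<psi> \<and>
          (\<forall>n\<ge>1. e n = int (enumerate (multiples_set a) (\<psi> n))))"

definition index_of :: "(nat \<Rightarrow> nat) \<Rightarrow> (nat \<Rightarrow> int) \<Rightarrow> nat \<Rightarrow> nat" where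
  "index_of a e k = (THE n. 1 \<le> n \<and> e n = int (a k))"

subsection \<open>Weak L-invariance\<close>

definition lifting :: "(nat \<Rightarrow> nat) \<Rightarrow> (nat \<Rightarrow> int) \<Rightarrow> nat set \<Rightarrow> nat set" where
  "lifting a e A = (\<Union>k\<in>A. {index_of a e (k - 1)..index_of a e k - 1})"

definition shift_down :: "nat set \<Rightarrow> nat \<Rightarrow> nat set" where
  "shift_down A m = {n. 1 \<le> n \<and> (\<exists>x\<in>A. int n = int x - int m)}"

definition weakly_L_invariant :: "(nat \<Rightarrow> nat) \<Rightarrow> (nat \<Rightarrow> int) \<Rightarrow> bool" where
  "weakly_L_invariant a e \<longleftrightarrow>
     (\<exists>A. A \<subseteq> {1..} \<and> infinite A \<and> (\<forall>m. has_density (lifting a e (shift_down A m)) 0))"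

subsection \<open>The statistically characterized subgroup\<close>

definition stat_null :: "(nat \<Rightarrow> circle) \<Rightarrow> bool" where
  "stat_null y \<longleftrightarrow> (\<forall>\<epsilon>>0. has_density {n. 1 \<le> n \<and> circle_norm (y n) \<ge> \<epsilon>} 0)"

definition stat_char_subgroup :: "(nat \<Rightarrow> int) \<Rightarrow> circle set" where
  "stat_char_subgroup e = {x. stat_null (\<lambda>n. circle_mult (e n) x)}"

end

theory Submission imports Defs begin

text \<open>
  For \<open>C \<subseteq> A\<close> put \<open>x = (\<Sum>j\<in>C. 1 / a\<^sub>j)\<close>. If \<open>n\<close> lies in the block \<open>[n\<^sub>p\<^sub>-\<^sub>1, n\<^sub>p - 1]\<close>, then \<open>e\<^sub>n\<close> is a
  multiple of \<open>a\<^sub>p\<^sub>-\<^sub>1\<close> smaller than \<open>a\<^sub>p\<close>, so modulo 1 only the terms with \<open>j \<ge> p\<close> contribute to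
  \<open>e\<^sub>n x\<close>. Unless \<open>n\<close> lies in one of the density zero sets \<open>L(A), L(A - 1), \<dots>, L(A - (m - 1))\<close>,
  even all \<open>j < p + m\<close> drop out, and what remains is at most \<open>2 / 2\<^sup>m\<close> because \<open>a\<^sub>p\<^sub>+\<^sub>i \<ge> 2\<^sup>i a\<^sub>p\<close>.
  Hence every such \<open>x\<close> belongs to the subgroup. Distinct \<open>C\<close> inside a fixed infinite subset of \<open>A\<close>
  without consecutive elements give points that are distinct modulo 1.
\<close>

subsection \<open>Sets of density zero\<close>

lemma has_density_iff_tendsto:
  "has_density A \<delta> \<longleftrightarrow> (\<lambda>n. real (card (A \<inter> {..<n})) / real n) \<longlonglongrightarrow> \<delta>"
  unfolding has_density_def upper_density_def lower_density_def
  by (subst lim_ereal[symmetric]) (auto simp: tendsto_iff_Liminf_eq_Limsup simp del: lim_ereal)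

lemma has_density_zero_subset:
  assumes "has_density B 0" and "A \<subseteq> B"
  shows "has_density A 0"
  unfolding has_density_iff_tendsto
proof (rule tendsto_sandwich[OF _ _ tendsto_const])
  show "(\<lambda>n. real (card (B \<inter> {..<n})) / real n) \<longlonglongrightarrow> 0"
    using assms(1) by (simp add: has_density_iff_tendsto)
  show "\<forall>\<^sub>F n in sequentially.
      real (card (A \<inter> {..<n})) / real n \<le> real (card (B \<inter> {..<n})) / real n"
    using assms(2) by (intro always_eventually allI divide_right_mono) (auto intro!: card_mono)
qed simp

lemma has_density_zero_Un:
  assumes "has_density A 0" and "has_density B 0"
  shows "has_density (A \<union> B) 0"
  unfolding has_density_iff_tendsto
proof (rule tendsto_sandwich[OF _ _ tendsto_const])
  show "(\<lambda>n. real (card (A \<inter> {..<n})) / real n + real (card (B \<inter> {..<n})) / real n) \<longlonglongrightarrow> 0"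
    using assms by (auto simp: has_density_iff_tendsto intro: tendsto_add_zero)
  have "card ((A \<union> B) \<inter> {..<n}) \<le> card (A \<inter> {..<n}) + card (B \<inter> {..<n})" for n
    using card_Un_le[of "A \<inter> {..<n}" "B \<inter> {..<n}"] by (simp add: Int_Un_distrib2)
  then show "\<forall>\<^sub>F n in sequentially. real (card ((A \<union> B) \<inter> {..<n})) / real n
      \<le> real (card (A \<inter> {..<n})) / real n + real (card (B \<inter> {..<n})) / real n"
    by (intro always_eventually allI)
      (metis add_divide_distrib divide_right_mono of_nat_0_le_iff of_nat_add of_nat_mono)
qed simp

lemma has_density_zero_UN:
  assumes "finite I" and "\<And>i. i \<in> I \<Longrightarrow> has_density (A i) 0"
  shows "has_density (\<Union>i\<in>I. A i) 0"
  using assms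
proof (induction I)
  case empty
  then show ?case by (simp add: has_density_iff_tendsto)
next
  case (insert i I)
  then show ?case by (simp add: has_density_zero_Un)
qed

subsection \<open>Arithmetic sequences\<close>

lemma arithmetic_sequence_dvd:
  assumes "arithmetic_sequence a" and "i \<le> j"
  shows "a i dvd a j"
  using assms(2) by (induction rule: dec_induct)
    (use assms(1) in \<open>auto simp: arithmetic_sequence_def intro: dvd_trans\<close>)

lemma arithmetic_sequence_pos:
  assumes "arithmetic_sequence a"
  shows "a i > 0"
proof -
  have "strict_mono a" "a 0 = 1"
    using assms by (simp_all add: arithmetic_sequence_def)
  then show ?thesis
    by (metis le0 less_one linorder_not_le neq0_conv strict_mono_less_eq)
qed

text \<open>A proper multiple is at least twice as large, so each step of the sequence at least
  doubles.\<close>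

lemma arithmetic_sequence_growth:
  assumes "arithmetic_sequence a"
  shows "2 ^ i * a p \<le> a (p + i)"
proof (induction i)
  case (Suc i)
  obtain q where q: "a (Suc (p + i)) = a (p + i) * q"
    using assms unfolding arithmetic_sequence_def by (meson dvdE)
  have "a (p + i) < a (Suc (p + i))"
    using assms by (simp add: arithmetic_sequence_def strict_mono_def)
  then have "2 \<le> q"
    using q by (cases q) (auto simp: Suc_le_eq)
  then have "2 * a (p + i) \<le> a (Suc (p + i))"
    using q by simp
  then show ?case
    using Suc by simp
qed simp

lemma ratio_mult:
  assumes "arithmetic_sequence a"
  shows "ratio a (Suc k) * a k = a (Suc k)"
  using assms by (simp add: ratio_def arithmetic_sequence_def)

lemma multiples_setE:
  assumes "arithmetic_sequence a" and "d \<in> multiples_set a"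
  obtains k r where "d = r * a k" and "a k \<le> d" and "d < a (Suc k)"
proof -
  obtain k r where kr: "d = r * a k" "1 \<le> r" "r < ratio a (Suc k)"
    using assms(2) by (auto simp: multiples_set_def)
  moreover have "d < a (Suc k)"
    using kr arithmetic_sequence_pos[OF assms(1)] ratio_mult[OF assms(1), of k]
    by (metis mult_less_cancel2)
  ultimately show ?thesis
    using that by simp
qed

text \<open>Ensures that every value of \<open>enumerate (multiples_set a)\<close> lies in the set.
  Each ratio exceeds 1, so r = 1 is always admissible.\<close>

lemma infinite_multiples_set:
  assumes "arithmetic_sequence a"
  shows "infinite (multiples_set a)"
proof -
  have "1 < ratio a (Suc k)" for k
  proof (rule ccontr)
    assume "\<not> 1 < ratio a (Suc k)"
    then have "ratio a (Suc k) * a k \<le> 1 * a k"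
      by (intro mult_right_mono) auto
    moreover have "a k < a (Suc k)"
      using assms by (simp add: arithmetic_sequence_def strict_mono_def)
    ultimately show False
      using ratio_mult[OF assms, of k] by simp
  qed
  then have "range a \<subseteq> multiples_set a"
    unfolding multiples_set_def by (force intro: exI[of _ 1])
  moreover have "infinite (range a)"
    using assms by (auto simp: arithmetic_sequence_def strict_mono_on_imp_inj_on range_inj_infinite)
  ultimately show ?thesis
    by (rule infinite_super)
qed

section \<open>Blocks of an arithmetic-type sequence\<close>

lemma index_of_props:
  assumes "arithmetic_type a e"
  shows "1 \<le> index_of a e k \<and> e (index_of a e k) = int (a k)"
proof -
  obtain n where n: "1 \<le> n" "e n = int (a k)"
    using assms by (auto simp: arithmetic_type_def) metis
  have "inj_on e {1..}"
    using assms by (simp add: arithmetic_type_def strict_mono_on_imp_inj_on)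
  then have "\<exists>!n. 1 \<le> n \<and> e n = int (a k)"
    using n by (auto simp: inj_on_def)
  then show ?thesis
    unfolding index_of_def by (rule theI')
qed

text \<open>Strict monotonicity of \<open>e\<close> turns \<open>a k\<close> <= \<open>e n\<close> <
  \<open>a (Suc k)\<close> into bounds on \<open>n\<close>. In the numbering of
  \<open>lifting\<close> this is block \<open>Suc k\<close>.\<close>

lemma arithmetic_type_block:
  assumes "arithmetic_sequence a" and "arithmetic_type a e" and "1 \<le> n"
  obtains k r where "e n = int (r * a k)" and "r * a k < a (Suc k)"
    and "n \<in> {index_of a e k..index_of a e (Suc k) - 1}"
proof -
  obtain \<psi> where "\<forall>n\<ge>1. e n = int (enumerate (multiples_set a) (\<psi> n))"
    using assms(2) unfolding arithmetic_type_def by blast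
  then obtain d where d: "d \<in> multiples_set a" "e n = int d"
    using assms(3) enumerate_in_set[OF infinite_multiples_set[OF assms(1)]] by blast
  obtain k r where kr: "d = r * a k" "a k \<le> d" "d < a (Suc k)"
    using multiples_setE[OF assms(1) d(1)] .
  have mono: "strict_mono_on {1..} e"
    using assms(2) by (simp add: arithmetic_type_def)
  have "index_of a e k \<le> n"
    using index_of_props[OF assms(2), of k] strict_mono_on_leD[OF mono] strict_mono_onD[OF mono]
      d kr assms(3) by (metis atLeast_iff linorder_not_le of_nat_le_iff)
  moreover have "n < index_of a e (Suc k)"
  proof (rule ccontr)
    assume "\<not> n < index_of a e (Suc k)"
    then have "e (index_of a e (Suc k)) \<le> e n"
      using index_of_props[OF assms(2), of "Suc k"] assms(3)
      by (intro strict_mono_on_leD[OF mono]) auto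
    then show False
      using index_of_props[OF assms(2), of "Suc k"] d(2) kr(3) by simp
  qed
  ultimately show ?thesis
    using that[of r k] d kr by auto
qed

subsection \<open>Series of reciprocals of an arithmetic sequence\<close>

text \<open>Doubling gives a geometric majorant from index \<open>p + m\<close> on, and
  \<open>m\<close> further doublings compare \<open>a (p + m)\<close> with \<open>a p\<close>.
  Signed coefficients are allowed so that differences of indicators are covered.\<close>

lemma arithmetic_series_tail:
  fixes g :: "nat \<Rightarrow> real"
  assumes a: "arithmetic_sequence a" and g: "\<And>j. \<bar>g j\<bar> \<le> 1"
  shows "summable (\<lambda>j. g j / a j)"
    and "\<bar>\<Sum>j. g (j + (p + m)) / a (j + (p + m))\<bar> \<le> 2 / 2 ^ m / a p"
proof -
  have bound: "norm (g (j + q) / a (j + q)) \<le> (1 / 2) ^ j * (1 / a q)" for j q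
  proof -
    have "real (2 ^ j * a q) \<le> real (a (j + q))"
      using arithmetic_sequence_growth[OF a, of j q] by (simp only: of_nat_le_iff add.commute)
    then have "\<bar>g (j + q)\<bar> / a (j + q) \<le> 1 / (2 ^ j * a q)"
      using g arithmetic_sequence_pos[OF a, of q] by (intro frac_le) auto
    then show ?thesis
      by (simp add: power_divide)
  qed
  have geom: "(\<lambda>j. (1 / 2) ^ j * (1 / real (a q))) sums (2 * (1 / a q))" for q
    using geometric_sums[of "1 / 2 :: real"] by (intro sums_mult2) simp
  show "summable (\<lambda>j. g j / a j)"
    by (rule summable_comparison_test'[OF sums_summable[OF geom[of 0]]])
      (use bound[of _ 0] in simp)
  have "\<bar>\<Sum>j. g (j + (p + m)) / a (j + (p + m))\<bar> \<le> 2 * (1 / a (p + m))"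
    using norm_suminf_le[OF bound sums_summable[OF geom], of "p + m"]
      sums_unique[OF geom, of "p + m"] by (simp only: real_norm_def)
  also have "\<dots> \<le> 2 / (2 ^ m * a p)"
  proof -
    have "real (2 ^ m * a p) \<le> real (a (p + m))"
      using arithmetic_sequence_growth[OF a, of m p] by (simp only: of_nat_le_iff)
    then show ?thesis
      using arithmetic_sequence_pos[OF a] by (auto intro!: divide_left_mono)
  qed
  finally show "\<bar>\<Sum>j. g (j + (p + m)) / a (j + (p + m))\<bar> \<le> 2 / 2 ^ m / a p"
    by simp
qed

definition reciprocal_sum :: "(nat \<Rightarrow> nat) \<Rightarrow> nat set \<Rightarrow> real" where
  "reciprocal_sum a C = (\<Sum>j. indicator C j / real (a j))"

lemma infdist_mult_reciprocal_sum:
  assumes a: "arithmetic_sequence a" and r: "r * a k < a (Suc k)"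
    and C: "\<And>i. i < m \<Longrightarrow> Suc k + i \<notin> C"
  shows "infdist (real (r * a k) * reciprocal_sum a C) \<int> \<le> 2 / 2 ^ m"
proof -
  let ?f = "\<lambda>j. indicator C j / real (a j)"
  \<comment> \<open>Below \<open>N\<close> each product of a term with \<open>r * a k\<close> is an
    integer: \<open>a j\<close> divides \<open>a k\<close> for \<open>j\<close> <= \<open>k\<close>,
    and the other indices avoid \<open>C\<close>.\<close>
  define N where "N = Suc k + m"
  define head where "head = real (r * a k) * (\<Sum>j<N. ?f j)"
  define tail where "tail = (\<Sum>j. ?f (j + N))"
  have "\<bar>indicator C j :: real\<bar> \<le> 1" for j
    by (simp add: indicator_def)
  note series = arithmetic_series_tail[OF a this]
  have f: "summable ?f"
    by (rule series)
  have tail: "\<bar>tail\<bar> \<le> 2 / 2 ^ m / a (Suc k)"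
    unfolding tail_def N_def by (rule series)
  have "real (r * a k) * ?f j \<in> \<int>" if "j < N" for j
  proof (cases "j \<le> k")
    case True
    then obtain q where "a k = a j * q"
      using arithmetic_sequence_dvd[OF a] by blast
    then have "real (r * a k) * ?f j = real (r * q) * indicator C j"
      using arithmetic_sequence_pos[OF a, of j] by simp
    then show ?thesis
      by (auto simp: indicator_def simp del: of_nat_mult)
  next
    case False
    then have "j \<notin> C"
      using C[of "j - Suc k"] that by (simp add: N_def)
    then show ?thesis by simp
  qed
  then have head: "head \<in> \<int>"
    unfolding head_def sum_distrib_left by (intro Ints_sum) auto
  have "reciprocal_sum a C = tail + (\<Sum>j<N. ?f j)"
    unfolding reciprocal_sum_def tail_def using f by (rule suminf_split_initial_segment)
  then have "real (r * a k) * reciprocal_sum a C = head + real (r * a k) * tail"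
    by (simp add: head_def algebra_simps)
  then have "infdist (real (r * a k) * reciprocal_sum a C) \<int> \<le> real (r * a k) * \<bar>tail\<bar>"
    using infdist_le[OF head, of "real (r * a k) * reciprocal_sum a C"]
    by (simp add: dist_real_def abs_mult)
  \<comment> \<open>The factor \<open>r * a k\<close> is smaller than \<open>a (Suc k)\<close>,
    which cancels the denominator of the tail bound.\<close>
  also have "\<dots> \<le> real (a (Suc k)) * (2 / 2 ^ m / a (Suc k))"
    using r tail by (intro mult_mono) (auto simp del: of_nat_mult)
  also have "\<dots> = 2 / 2 ^ m"
    using arithmetic_sequence_pos[OF a, of "Suc k"] by simp
  finally show ?thesis .
qed

section \<open>Membership in the subgroup and distinctness modulo 1\<close>

lemma reciprocal_sum_in_subgroup:
  assumes a: "arithmetic_sequence a" and e: "arithmetic_type a e"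
    and A: "\<And>m. has_density (lifting a e (shift_down A m)) 0" and "C \<subseteq> A"
  shows "abs_circle (reciprocal_sum a C) \<in> stat_char_subgroup e"
  unfolding stat_char_subgroup_def stat_null_def mem_Collect_eq
proof (intro allI impI)
  fix \<epsilon> :: real
  assume "\<epsilon> > 0"
  \<comment> \<open>This makes the distance bound 2 / 2^m smaller than epsilon, so only finitely
    many shifts of \<open>A\<close> matter.\<close>
  then obtain m where m: "(1 / 2) ^ m < \<epsilon> / 2"
    using real_arch_pow_inv[of "\<epsilon> / 2" "1 / 2"] by auto
  have "{n. 1 \<le> n \<and> \<epsilon> \<le> circle_norm (circle_mult (e n) (abs_circle (reciprocal_sum a C)))}
      \<subseteq> (\<Union>i\<in>{..<m}. lifting a e (shift_down A i))"
  proof clarify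
    fix n
    assume n: "1 \<le> n"
      and ge: "\<epsilon> \<le> circle_norm (circle_mult (e n) (abs_circle (reciprocal_sum a C)))"
    obtain k r where kr: "e n = int (r * a k)" "r * a k < a (Suc k)"
      "n \<in> {index_of a e k..index_of a e (Suc k) - 1}"
      using arithmetic_type_block[OF a e n] .
    have "\<epsilon> \<le> infdist (real (r * a k) * reciprocal_sum a C) \<int>"
      using ge unfolding circle_mult.abs_eq circle_norm.abs_eq kr(1) by simp
    then have "\<not> infdist (real (r * a k) * reciprocal_sum a C) \<int> \<le> 2 / 2 ^ m"
      using m by (simp add: power_divide)
    then obtain i where i: "i < m" "Suc k + i \<in> C"
      using infdist_mult_reciprocal_sum[OF a kr(2)] by blast
    then have "Suc k \<in> shift_down A i"
      using \<open>C \<subseteq> A\<close> by (force simp: shift_down_def)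
    then have "n \<in> lifting a e (shift_down A i)"
      unfolding lifting_def using kr(3) by force
    then show "n \<in> (\<Union>i\<in>{..<m}. lifting a e (shift_down A i))"
      using i(1) by blast
  qed
  then show "has_density
      {n. 1 \<le> n \<and> \<epsilon> \<le> circle_norm (circle_mult (e n) (abs_circle (reciprocal_sum a C)))} 0"
    using has_density_zero_UN[OF finite_lessThan A] by (rule has_density_zero_subset[rotated])
qed

text \<open>At the first difference \<open>j\<close> the term is 1 / \<open>a j\<close>. Neither set
  contains \<open>Suc j\<close>, so the rest starts at \<open>j + 2\<close> and is at most half of
  that in absolute value. Hence the difference lies strictly between 0 and 1. Without the gap, the
  rest could cancel the leading term.\<close>

lemma reciprocal_sum_diff_notin_Ints:
  assumes a: "arithmetic_sequence a"
    and B: "0 \<notin> B" "\<And>j. j \<in> B \<Longrightarrow> Suc j \<notin> B"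
    and CD: "C \<subseteq> B" "D \<subseteq> B" "j \<in> C" "j \<notin> D" "\<And>i. i < j \<Longrightarrow> i \<in> C \<longleftrightarrow> i \<in> D"
  shows "reciprocal_sum a C - reciprocal_sum a D \<notin> \<int>"
proof -
  define g where "g i = (indicator C i - indicator D i :: real)" for i
  define tail where "tail = (\<Sum>i. g (i + (j + 2)) / a (i + (j + 2)))"
  have sum: "summable (\<lambda>i. indicator C i / real (a i))" for C
    using arithmetic_series_tail(1)[OF a, of "indicator C"] by (auto simp: indicator_def)
  have "\<bar>g i\<bar> \<le> 1" for i
    by (simp add: g_def indicator_def)
  note series = arithmetic_series_tail[OF a this]
  have g: "summable (\<lambda>i. g i / a i)"
    by (rule series)
  have tail: "\<bar>tail\<bar> \<le> 1 / 2 / a j"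
    using series(2)[where p = j and m = 2] by (simp add: tail_def)
  have "reciprocal_sum a C - reciprocal_sum a D = (\<Sum>i. g i / a i)"
    unfolding reciprocal_sum_def g_def by (simp add: suminf_diff sum diff_divide_distrib)
  also have "\<dots> = tail + (\<Sum>i<j + 2. g i / a i)"
    unfolding tail_def using g by (rule suminf_split_initial_segment)
  also have "(\<Sum>i<j + 2. g i / a i) = 1 / a j"
  proof -
    have "g i = 0" if "i < j" for i
      using CD(5)[OF that] by (simp add: g_def indicator_def)
    moreover have "Suc j \<notin> C" "Suc j \<notin> D"
      using B(2)[of j] CD by auto
    ultimately show ?thesis
      using CD(3,4) by (simp add: g_def)
  qed
  finally have eq: "reciprocal_sum a C - reciprocal_sum a D = tail + 1 / a j" .
  \<comment> \<open>Index 0 must be excluded: since \<open>a 0\<close> = 1, its term is an integer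
    and vanishes modulo 1.\<close>
  have "j \<noteq> 0"
    using B(1) CD(1,3) by (metis subsetD)
  then have "2 \<le> a j"
    using a arithmetic_sequence_growth[OF a, of 1 "j - 1"]
      arithmetic_sequence_pos[OF a, of "j - 1"] by simp
  then have "1 / a j \<le> 1 / 2" "0 < 1 / real (a j)"
    by (auto simp: field_simps)
  moreover have "\<bar>tail\<bar> \<le> 1 / 2 * (1 / a j)"
    using tail by simp
  ultimately have "0 < tail + 1 / a j" "tail + 1 / a j < 1"
    by linarith+
  then show ?thesis
    unfolding eq by (auto elim!: Ints_cases)
qed

lemma inj_on_reciprocal_sum:
  assumes a: "arithmetic_sequence a" and B: "0 \<notin> B" "\<And>j. j \<in> B \<Longrightarrow> Suc j \<notin> B"
  shows "inj_on (\<lambda>C. abs_circle (reciprocal_sum a C)) (Pow B)"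
proof (rule inj_onI, rule ccontr)
  fix C D
  assume CD: "C \<in> Pow B" "D \<in> Pow B" "C \<noteq> D"
    and "abs_circle (reciprocal_sum a C) = abs_circle (reciprocal_sum a D)"
  then have Ints: "reciprocal_sum a C - reciprocal_sum a D \<in> \<int>"
    by (simp add: circle.abs_eq_iff)
  then have Ints': "reciprocal_sum a D - reciprocal_sum a C \<in> \<int>"
    using Ints_minus by fastforce
  \<comment> \<open>The preceding lemma wants the least difference to lie in its first set, so the
    roles of \<open>C\<close> and \<open>D\<close> are swapped if necessary.\<close>
  define j where "j = (LEAST j. (j \<in> C) \<noteq> (j \<in> D))"
  have j: "(j \<in> C) \<noteq> (j \<in> D)"
    unfolding j_def by (rule LeastI_ex) (use CD in blast)
  have less: "i \<in> C \<longleftrightarrow> i \<in> D" if "i < j" for i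
    using not_less_Least that unfolding j_def by blast
  show False
  proof (cases "j \<in> C")
    case True
    then show False
      using reciprocal_sum_diff_notin_Ints[OF a B, of C D j] CD Ints j less by auto
  next
    case False
    then show False
      using reciprocal_sum_diff_notin_Ints[OF a B, of D C j] CD Ints' j less by auto
  qed
qed

section \<open>Thinning and cardinality\<close>

lemma infinite_subset_no_consecutive:
  fixes A :: "nat set"
  assumes "infinite A"
  obtains B where "B \<subseteq> A" and "infinite B" and "\<And>j. j \<in> B \<Longrightarrow> Suc j \<notin> B"
proof
  \<comment> \<open>Keep every other element of \<open>A\<close>: the skipped element lies strictly
    between two kept ones, so these cannot be consecutive integers.\<close>
  let ?c = "\<lambda>i. enumerate A (2 * i)"
  have mono: "strict_mono (enumerate A)"
    using assms by (rule strict_mono_enumerate)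
  show "range ?c \<subseteq> A"
    using assms by (auto simp: enumerate_in_set)
  show "infinite (range ?c)"
    using mono by (intro range_inj_infinite injI) (simp add: strict_mono_eq)
  show "Suc j \<notin> range ?c" if j: "j \<in> range ?c" for j
  proof
    assume "Suc j \<in> range ?c"
    then obtain i l where il: "j = ?c i" "Suc j = ?c l"
      using j by blast
    have "2 * i < 2 * l"
      using il mono by (metis lessI strict_mono_less)
    then have "2 * i < 2 * i + 1" "2 * i + 1 < 2 * l"
      by auto
    then have "?c i < enumerate A (2 * i + 1)" "enumerate A (2 * i + 1) < ?c l"
      using mono by (simp_all only: strict_mono_less)
    then show False
      using il by simp
  qed
qed

text \<open>Choosing a representative of each class is injective.\<close>

lemma circle_lepoll_reals: "(X :: circle set) \<lesssim> (UNIV :: real set)"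
proof -
  have "inj rep_circle"
    by (metis Quotient3_abs_rep Quotient3_circle injI)
  then show ?thesis
    unfolding lepoll_def by (metis inj_on_subset subset_UNIV)
qed

theorem theorem3p5:
  fixes a :: "nat \<Rightarrow> nat" and e :: "nat \<Rightarrow> int"
  assumes "arithmetic_sequence a"
    and "arithmetic_type a e"
    and "weakly_L_invariant a e"
  shows "stat_char_subgroup e \<approx> (UNIV :: real set)"
proof (rule lepoll_antisym[OF circle_lepoll_reals])
  obtain A where A: "A \<subseteq> {1..}" "infinite A"
      "\<And>m. has_density (lifting a e (shift_down A m)) 0"
    using assms(3) by (auto simp: weakly_L_invariant_def)
  obtain B where B: "B \<subseteq> A" "infinite B" "\<And>j. j \<in> B \<Longrightarrow> Suc j \<notin> B"
    using infinite_subset_no_consecutive[OF A(2)] by blast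
  have "(UNIV :: nat set) \<lesssim> B"
    using B(2) by (simp add: infinite_le_lepoll)
  \<comment> \<open>Taking images under an injection is injective on power sets.\<close>
  then have "Pow (UNIV :: nat set) \<lesssim> Pow B"
    unfolding lepoll_def by (metis inj_on_image_Pow image_Pow_mono)
  also have "Pow B \<lesssim> stat_char_subgroup e"
    unfolding lepoll_def
  proof (intro exI conjI)
    show "inj_on (\<lambda>C. abs_circle (reciprocal_sum a C)) (Pow B)"
      \<comment> \<open>\<open>A(1)\<close> keeps 0 out of \<open>B\<close>.\<close>
      using A(1) B by (intro inj_on_reciprocal_sum assms(1)) auto
    show "(\<lambda>C. abs_circle (reciprocal_sum a C)) ` Pow B \<subseteq> stat_char_subgroup e"
      using reciprocal_sum_in_subgroup[OF assms(1,2) A(3)] B(1) by blast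
  qed
  finally have "(UNIV :: nat set set) \<lesssim> stat_char_subgroup e"
    by simp
  then show "(UNIV :: real set) \<lesssim> stat_char_subgroup e"
    using nat_sets_eqpoll_reals by (meson eqpoll_sym lepoll_trans1)
qed

end
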